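(* Let $1\le k<n$ and let $(V,\mathcal{H})$ be a $k$-hypergraph with $n=|V|$ vertices. Suppose that at least one of the following holds: (1) $k\in\{1,2\}$ (so $(V,\mathcal{H})$ is an arbitrary $1$-hypergraph or an arbitrary graph); (2) $(V,\mathcal{H})$ is a $k$-partite hypergraph with respect to some $k$-partition $V=V_1\uplus\cdots\uplus V_k$ of its vertex set; (3) $(V,\mathcal{H})$ is a paving $k$-matroid; (4) $(V,\mathcal{H})$ is a binary $k$-matroid; (5) $k=3$ and $(V,\mathcal{H})$ is a $3$-matroid. Then $(V,\mathcal{H})$ is equatable if and only if it is exchangeable.
   Context: A $k$-hypergraph is a pair $(V,\mathcal{H})$ with $V$ a finite set and $\mathcal{H}\subseteq\binom{V}{k}$ a set of $k$-element subsets of $V$ (the edges). Its complement is $\overline{\mathcal{H}}:=\binom{V}{k}\setminus\mathcal{H}$. Standing assumption: $1\le k<n:=|V|$. Equatable: there is a labeling $y:\binom{V}{k}\to\mathbb{R}_{\ge 0}$, not identically zero, such that for every $v\in V$, $\sum\{y(E):v\in E\in\mathcal{H}\}=\sum\{y(F):v\in F\in\overline{\mathcal{H}}\}$. Exchangeable: there are $E_1,E_2\in\mathcal{H}$, $v_1\in E_1\setminus E_2$ and $v_2\in E_2\setminus E_1$ such that $(E_1\setminus\{v_1\})\cup\{v_2\}\in\overline{\mathcal{H}}$ and $(E_2\setminus\{v_2\})\cup\{v_1\}\in\overline{\mathcal{H}}$. $k$-partite hypergraph: a $k$-hypergraph $(V,\mathcal{H})$ with a specified partition $V=V_1\uplus\cdots\uplus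 V_k$ into pairwise disjoint sets such that $|E\cap V_i|=1$ for every $E\in\mathcal{H}$ and every $i=1,\dots,k$. $k$-matroid: a $k$-hypergraph $(V,\mathcal{H})$ with $\mathcal{H}\ne\emptyset$ such that for every $E_1,E_2\in\mathcal{H}$ and $v_1\in E_1\setminus E_2$ there is $v_2\in E_2\setminus E_1$ with $(E_1\setminus\{v_1\})\cup\{v_2\}\in\mathcal{H}$ (that is, $\mathcal{H}$ is the set of bases of a rank $k$ matroid on $V$). A set $I\subseteq V$ is independent if $I\subseteq E$ for some $E\in\mathcal{H}$. A circuit is a subset of $V$ which is not independent but all of whose proper subsets are independent. Paving $k$-matroid: a $k$-matroid in which every $(k-1)$-subset of $V$ is independent. Binary $k$-matroid: a $k$-matroid in which, for any two distinct circuits $C_1,C_2$, the symmetric difference $C_1\Delta C_2$ is a disjoint union of circuits. *)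

theory Defs
  imports Complex_Main "HOL-Library.Ramsey" "HOL-Library.Disjoint_Sets"
begin

text \<open>The collection of all \<open>k\<close>-element subsets of \<open>V\<close> is \<open>nsets V k\<close> from Ramsey theory.\<close>

definition hypergraph :: "nat \<Rightarrow> 'a set \<Rightarrow> 'a set set \<Rightarrow> bool" where
  "hypergraph k V H \<longleftrightarrow> finite V \<and> H \<subseteq> nsets V k"

definition hyper_compl :: "nat \<Rightarrow> 'a set \<Rightarrow> 'a set set \<Rightarrow> 'a set set" where
  "hyper_compl k V H = nsets V k - H"

text \<open>A labeling is a total function on \<open>'a set\<close>; only its values on \<open>nsets V k\<close> matter,
  so nonnegativity and not vanishing identically are required there.\<close>

definition equatable :: "nat \<Rightarrow> 'a set \<Rightarrow> 'a set set \<Rightarrow> bool" where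
  "equatable k V H \<longleftrightarrow>
     (\<exists>y :: 'a set \<Rightarrow> real.
        (\<forall>E \<in> nsets V k. y E \<ge> 0) \<and>
        (\<exists>E \<in> nsets V k. y E \<noteq> 0) \<and>
        (\<forall>v \<in> V. (\<Sum>E | E \<in> H \<and> v \<in> E. y E) = (\<Sum>F | F \<in> hyper_compl k V H \<and> v \<in> F. y F)))"

definition exchangeable :: "nat \<Rightarrow> 'a set \<Rightarrow> 'a set set \<Rightarrow> bool" where
  "exchangeable k V H \<longleftrightarrow>
     (\<exists>E1 \<in> H. \<exists>E2 \<in> H. \<exists>v1 \<in> E1 - E2. \<exists>v2 \<in> E2 - E1.
        (E1 - {v1}) \<union> {v2} \<in> hyper_compl k V H \<and>
        (E2 - {v2}) \<union> {v1} \<in> hyper_compl k V H)"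

text \<open>The parts are indexed by \<open>{1..k}\<close>. They are not required to be nonempty, which is
  automatic as soon as there is an edge.\<close>

definition partite_hypergraph ::
    "nat \<Rightarrow> 'a set \<Rightarrow> 'a set set \<Rightarrow> (nat \<Rightarrow> 'a set) \<Rightarrow> bool" where
  "partite_hypergraph k V H P \<longleftrightarrow>
     hypergraph k V H \<and>
     V = (\<Union>i\<in>{1..k}. P i) \<and> disjoint_family_on P {1..k} \<and>
     (\<forall>E \<in> H. \<forall>i \<in> {1..k}. card (E \<inter> P i) = 1)"

definition matroid :: "nat \<Rightarrow> 'a set \<Rightarrow> 'a set set \<Rightarrow> bool" where
  "matroid k V H \<longleftrightarrow>
     hypergraph k V H \<and> H \<noteq> {} \<and>
     (\<forall>E1 \<in> H. \<forall>E2 \<in> H. \<forall>v1 \<in> E1 - E2. \<exists>v2 \<in> E2 - E1. (E1 - {v1}) \<union> {v2} \<in> H)"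

definition independent_set :: "'a set \<Rightarrow> 'a set set \<Rightarrow> 'a set \<Rightarrow> bool" where
  "independent_set V H I \<longleftrightarrow> I \<subseteq> V \<and> (\<exists>E \<in> H. I \<subseteq> E)"

definition circuit :: "'a set \<Rightarrow> 'a set set \<Rightarrow> 'a set \<Rightarrow> bool" where
  "circuit V H C \<longleftrightarrow>
     C \<subseteq> V \<and> \<not> independent_set V H C \<and> (\<forall>I. I \<subset> C \<longrightarrow> independent_set V H I)"

definition paving_matroid :: "nat \<Rightarrow> 'a set \<Rightarrow> 'a set set \<Rightarrow> bool" where
  "paving_matroid k V H \<longleftrightarrow>
     matroid k V H \<and> (\<forall>I \<in> nsets V (k - 1). independent_set V H I)"

definition binary_matroid :: "nat \<Rightarrow> 'a set \<Rightarrow> 'a set set \<Rightarrow> bool" where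
  "binary_matroid k V H \<longleftrightarrow>
     matroid k V H \<and>
     (\<forall>C1 C2. circuit V H C1 \<and> circuit V H C2 \<and> C1 \<noteq> C2 \<longrightarrow>
        (\<exists>\<D>. (\<forall>D \<in> \<D>. circuit V H D) \<and> disjoint \<D> \<and> \<Union>\<D> = sym_diff C1 C2))"

end

theory Submission
  imports Defs
begin

text \<open>
  An exchange replaces two edges by two non-edges that cover every vertex equally often, so the
  labeling with value 1 on these four sets shows that an exchangeable hypergraph is equatable.

  The converse is proved by contraposition, and it rests on two observations. If vertex weights
  separate the edges from the other \<open>k\<close>-sets by a threshold, then pairing the weights with a
  balanced nonnegative labeling forces the labeling to vanish
  (\<open>separable_imp_not_equatable\<close>). On the other side, compare vertices by letting \<open>u\<close> be at
  least as good as \<open>v\<close> if replacing \<open>v\<close> by \<open>u\<close> never destroys an edge. Two incomparable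
  vertices are the same thing as an exchange, so without exchanges the comparison is a total
  preorder and is represented by a rank function (\<open>not_exchangeable_imp_shifted\<close>). It remains
  to find separating weights for such shifted hypergraphs in each of the classes considered.

  For \<open>k = 1\<close> the indicator weights do. For graphs there is a shortcut that avoids weights: among
  the vertices covered by the support of a balanced labeling, the best and the worst one cannot
  both have positive label on edges and on non-edges.

  A shifted \<open>k\<close>-partite hypergraph with an edge and a shifted binary matroid have the same form:
  a fixed edge \<open>B\<close> together with all sets obtained from it by exchanging some \<open>x\<close> in \<open>Q\<close> for some
  \<open>p\<close> in \<open>P\<close>. The weights 3, 2, 1, 0 on \<open>B - Q\<close>, \<open>Q\<close>, \<open>P\<close> and the rest separate it
  (\<open>star_separable\<close>). In a shifted paving matroid all non-bases lie in one hyperplane, the one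
  spanned by the \<open>k - 1\<close> worst vertices, and the indicator of its complement separates. A shifted
  matroid of rank three is described by one parallel class inside one line, and it is separated by
  weights that depend on the position relative to this flag.
\<close>

section \<open>Labelings and separating weights\<close>

text \<open>
  The two edges of an exchange and the two non-edges that it produces use the same vertices with
  the same multiplicities, so labeling these four sets by 1 is balanced.
\<close>

lemma exchangeable_imp_equatable:
  assumes hyp: "hypergraph k V H" and ex: "exchangeable k V H"
  shows "equatable k V H"
proof -
  obtain E1 E2 v1 v2 where E: "E1 \<in> H" "E2 \<in> H" and v: "v1 \<in> E1 - E2" "v2 \<in> E2 - E1"
    and F: "insert v2 (E1 - {v1}) \<in> hyper_compl k V H" "insert v1 (E2 - {v2}) \<in> hyper_compl k V H"
    using ex unfolding exchangeable_def by auto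
  define F1 where "F1 = insert v2 (E1 - {v1})"
  define F2 where "F2 = insert v1 (E2 - {v2})"
  define y :: "'a set \<Rightarrow> real" where "y X = of_bool (X \<in> {E1, E2, F1, F2})" for X
  have fin: "finite H" "finite (hyper_compl k V H)" "H \<subseteq> nsets V k"
    using hyp by (auto simp: hypergraph_def hyper_compl_def intro: finite_imp_finite_nsets finite_subset)
  have F': "F1 \<in> hyper_compl k V H" "F2 \<in> hyper_compl k V H"
    using F by (simp_all add: F1_def F2_def)
  then have disj: "F1 \<notin> H" "F2 \<notin> H"
    by (auto simp: hyper_compl_def)
  have ne: "E1 \<noteq> E2" "F1 \<noteq> F2"
    using v by (auto simp: F1_def F2_def)
  have sum2: "(\<Sum>X | X \<in> A \<and> u \<in> X. y X) = of_bool (u \<in> X1) + of_bool (u \<in> X2)"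
    if "finite A" "X1 \<in> A" "X2 \<in> A" "X1 \<noteq> X2" "A \<inter> {E1, E2, F1, F2} = {X1, X2}" for A X1 X2 u
  proof -
    have "X \<in> {E1, E2, F1, F2} \<longleftrightarrow> X \<in> {X1, X2}" if "X \<in> A" for X
      using that \<open>A \<inter> {E1, E2, F1, F2} = {X1, X2}\<close> by blast
    then have y1: "y X = of_bool (X \<in> {X1, X2})" if "X \<in> A" for X
      unfolding y_def using that by presburger
    have "(\<Sum>X | X \<in> A \<and> u \<in> X. y X) = (\<Sum>X\<in>A. if u \<in> X then y X else 0)"
      by (rule sum.inter_filter [OF that(1)])
    also have "\<dots> = (\<Sum>X\<in>{X1, X2}. of_bool (u \<in> X))"
      by (rule sum.mono_neutral_cong_right [OF that(1)]) (use that(2,3) in \<open>auto simp: y1\<close>)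
    also have "\<dots> = of_bool (u \<in> X1) + of_bool (u \<in> X2)"
      using that(4) by simp
    finally show ?thesis .
  qed
  have "(\<Sum>X | X \<in> H \<and> u \<in> X. y X) = (\<Sum>X | X \<in> hyper_compl k V H \<and> u \<in> X. y X)" for u
  proof -
    have "(\<Sum>X | X \<in> H \<and> u \<in> X. y X) = of_bool (u \<in> E1) + of_bool (u \<in> E2)"
      using E ne disj by (intro sum2 fin) blast+
    also have "\<dots> = of_bool (u \<in> F1) + of_bool (u \<in> F2)"
      using v by (auto simp: F1_def F2_def)
    also have "\<dots> = (\<Sum>X | X \<in> hyper_compl k V H \<and> u \<in> X. y X)"
      using E F' ne unfolding hyper_compl_def
      by (intro sum2 [symmetric] fin(2) [unfolded hyper_compl_def]) blast+
    finally show ?thesis .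
  qed
  moreover have "E1 \<in> nsets V k" "y E1 \<noteq> 0"
    using E fin by (blast, simp add: y_def)
  moreover have "\<forall>X \<in> nsets V k. 0 \<le> y X"
    by (simp add: y_def)
  ultimately show ?thesis
    unfolding equatable_def by blast
qed

definition separable :: "nat \<Rightarrow> 'a set \<Rightarrow> 'a set set \<Rightarrow> bool" where
  "separable k V H \<longleftrightarrow>
     (\<exists>(w :: 'a \<Rightarrow> real) t. (\<forall>E \<in> H. t < sum w E) \<and> (\<forall>F \<in> hyper_compl k V H. sum w F < t))"

text \<open>
  Summing the balance conditions of a labeling against the weights gives equality of
  \<open>\<Sum> y E (w E - t)\<close> over the edges and over the non-edges. The first sum has nonnegative and the
  second has nonpositive terms, so all terms vanish. The threshold is absorbed into the weights,
  which is possible because all sets in question have exactly \<open>k\<close> elements.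
\<close>

lemma separable_imp_not_equatable:
  assumes k: "1 \<le> k" and hyp: "hypergraph k V H" and sep: "separable k V H"
  shows "\<not> equatable k V H"
proof
  assume "equatable k V H"
  then obtain y :: "'a set \<Rightarrow> real" where y0: "\<And>E. E \<in> nsets V k \<Longrightarrow> y E \<ge> 0"
    and yne: "\<exists>E \<in> nsets V k. y E \<noteq> 0"
    and bal: "\<And>v. v \<in> V \<Longrightarrow> (\<Sum>E | E \<in> H \<and> v \<in> E. y E) = (\<Sum>F | F \<in> hyper_compl k V H \<and> v \<in> F. y F)"
    unfolding equatable_def by blast
  obtain w :: "'a \<Rightarrow> real" and t where w: "\<And>E. E \<in> H \<Longrightarrow> t < sum w E"
    "\<And>F. F \<in> hyper_compl k V H \<Longrightarrow> sum w F < t"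
    using sep unfolding separable_def by blast
  have fin: "finite V" "finite H" "finite (hyper_compl k V H)" and sub: "H \<subseteq> nsets V k"
    using hyp by (auto simp: hypergraph_def hyper_compl_def intro: finite_imp_finite_nsets finite_subset)
  define u where "u v = w v - t / real k" for v
  have u: "sum u E = sum w E - t" if "E \<in> nsets V k" for E
    using that k by (simp add: u_def sum_subtractf nsets_def)
  have swap: "(\<Sum>v\<in>V. u v * (\<Sum>E | E \<in> A \<and> v \<in> E. y E)) = (\<Sum>E\<in>A. y E * sum u E)"
    if "A \<subseteq> nsets V k" "finite A" for A
  proof -
    have "(\<Sum>v\<in>V. u v * (\<Sum>E | E \<in> A \<and> v \<in> E. y E)) = (\<Sum>v\<in>V. \<Sum>E | E \<in> A \<and> v \<in> E. u v * y E)"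
      by (simp add: sum_distrib_left)
    also have "\<dots> = (\<Sum>E\<in>A. \<Sum>v | v \<in> V \<and> v \<in> E. u v * y E)"
      using fin that by (intro sum.swap_restrict)
    also have "\<dots> = (\<Sum>E\<in>A. y E * sum u E)"
    proof (rule sum.cong)
      fix E assume "E \<in> A"
      then have "{v. v \<in> V \<and> v \<in> E} = E"
        using that by (auto simp: nsets_def)
      then show "(\<Sum>v | v \<in> V \<and> v \<in> E. u v * y E) = y E * sum u E"
        by (simp add: sum_distrib_left mult.commute)
    qed simp
    finally show ?thesis .
  qed
  have eq: "(\<Sum>E\<in>H. y E * sum u E) = (\<Sum>F\<in>hyper_compl k V H. y F * sum u F)"
    using swap [of H] swap [of "hyper_compl k V H"] fin sub bal by (simp add: hyper_compl_def)
  have pos: "0 < sum u E" if "E \<in> H" for E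
    using that w(1) u sub by force
  have neg: "sum u F < 0" if "F \<in> hyper_compl k V H" for F
    using that w(2) [of F] u [of F] by (simp add: hyper_compl_def)
  have H0: "0 \<le> y E * sum u E" if "E \<in> H" for E
    using that pos y0 sub by (simp add: less_imp_le subset_iff)
  have F0: "y F * sum u F \<le> 0" if "F \<in> hyper_compl k V H" for F
    using that neg y0 by (simp add: hyper_compl_def less_imp_le mult_nonneg_nonpos)
  have "0 \<le> (\<Sum>E\<in>H. y E * sum u E)" "(\<Sum>F\<in>hyper_compl k V H. y F * sum u F) \<le> 0"
    using H0 F0 by (auto intro: sum_nonneg sum_nonpos)
  then have "(\<Sum>E\<in>H. y E * sum u E) = 0"
    using eq by linarith
  then have "\<forall>E\<in>H. y E * sum u E = 0" "\<forall>F\<in>hyper_compl k V H. y F * sum u F = 0"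
    using sum_nonneg_eq_0_iff [OF fin(2), of "\<lambda>E. y E * sum u E"] H0
      sum_nonneg_eq_0_iff [OF fin(3), of "\<lambda>E. - (y E * sum u E)"] F0 eq
    by (auto simp: sum_negf)
  then have "y E = 0" if "E \<in> nsets V k" for E
    using that pos neg by (cases "E \<in> H") (force simp: hyper_compl_def)+
  with yne show False by blast
qed

section \<open>Ranking the vertices\<close>

text \<open>
  An arbitrary rank function is used in place of an ordering of the vertices; ties are harmless,
  and they mean that the two vertices are interchangeable.
\<close>

definition shifted :: "'a set \<Rightarrow> 'a set set \<Rightarrow> ('a \<Rightarrow> nat) \<Rightarrow> bool" where
  "shifted V H r \<longleftrightarrow>
     (\<forall>E \<in> H. \<forall>v \<in> E. \<forall>u \<in> V - E. r v \<le> r u \<longrightarrow> insert u (E - {v}) \<in> H)"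

lemma shiftedD:
  assumes "shifted V H r" "E \<in> H" "v \<in> E" "u \<in> V" "u \<notin> E" "r v \<le> r u"
  shows "insert u (E - {v}) \<in> H"
  using assms unfolding shifted_def by blast

lemma nsets_swap:
  assumes "E \<in> nsets V k" "v \<in> E" "u \<in> V" "u \<notin> E"
  shows "insert u (E - {v}) \<in> nsets V k"
proof -
  have E: "finite E" "card E = k" "E \<subseteq> V" using assms(1) by (auto simp: nsets_def)
  then have "card (insert u (E - {v})) = Suc (card (E - {v}))" using assms(4) by simp
  also have "\<dots> = k" using card_Suc_Diff1 [OF E(1) assms(2)] E(2) by simp
  finally show ?thesis using E assms(3) by (auto simp: nsets_def)
qed

text \<open>
  If neither of \<open>u\<close>, \<open>v\<close> can always replace the other, the two edges that witness this form an
  exchange. Hence without exchanges domination is a total preorder on the vertices, and counting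
  the dominated vertices turns it into a rank.
\<close>

lemma not_exchangeable_imp_shifted:
  assumes hyp: "hypergraph k V H" and nex: "\<not> exchangeable k V H"
  shows "\<exists>r. shifted V H r"
proof -
  have fin: "finite V" and sub: "H \<subseteq> nsets V k"
    using hyp by (auto simp: hypergraph_def)
  \<comment> \<open>\<open>D u v\<close> says that \<open>u\<close> can replace \<open>v\<close> in every edge.\<close>
  define D where "D u v \<longleftrightarrow> (\<forall>E\<in>H. v \<in> E \<longrightarrow> u \<notin> E \<longrightarrow> insert u (E - {v}) \<in> H)" for u v
  have DD: "insert u (E - {v}) \<in> H" if "D u v" "E \<in> H" "v \<in> E" "u \<notin> E" for u v E
    using that by (auto simp: D_def)
  have total: "D u v \<or> D v u" if uv: "u \<in> V" "v \<in> V" for u v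
  proof (rule ccontr)
    assume "\<not> (D u v \<or> D v u)"
    then obtain E1 E2 where
      E1: "E1 \<in> H" "v \<in> E1" "u \<notin> E1" "insert u (E1 - {v}) \<notin> H" and
      E2: "E2 \<in> H" "u \<in> E2" "v \<notin> E2" "insert v (E2 - {u}) \<notin> H"
      unfolding D_def by blast
    have "insert u (E1 - {v}) \<in> hyper_compl k V H" "insert v (E2 - {u}) \<in> hyper_compl k V H"
      using E1 E2 sub uv by (auto simp: hyper_compl_def intro!: nsets_swap)
    then have "exchangeable k V H"
      unfolding exchangeable_def using E1 E2
      by (intro bexI [of _ E1] bexI [of _ E2] bexI [of _ v] bexI [of _ u]) auto
    with nex show False ..
  qed
  have trans: "D u w" if uv: "D u v" and vw: "D v w" for u v w
    unfolding D_def
  proof (intro ballI impI)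
    fix E assume E: "E \<in> H" "w \<in> E" "u \<notin> E"
    consider "v = w" | "v = u" | "v \<noteq> w" "v \<in> E" | "v \<noteq> u" "v \<notin> E" by blast
    then show "insert u (E - {w}) \<in> H"
    proof cases
      case 1 then show ?thesis using DD uv E by simp
    next
      case 2 then show ?thesis using DD vw E by simp
    next
      case 3
      then have "insert u (E - {v}) \<in> H" using DD uv E by simp
      then have "insert v (insert u (E - {v}) - {w}) \<in> H"
        by (rule DD [OF vw]) (use E 3 in auto)
      moreover have "insert v (insert u (E - {v}) - {w}) = insert u (E - {w})"
        using E(2,3) 3 by blast
      ultimately show ?thesis by simp
    next
      case 4
      then have "insert v (E - {w}) \<in> H" using DD vw E by simp
      then have "insert u (insert v (E - {w}) - {v}) \<in> H"
        by (rule DD [OF uv]) (use E 4 in auto)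
      then show ?thesis using 4 by simp
    qed
  qed
  define r where "r v = card {x\<in>V. D v x}" for v
  have rD: "D u v" if "r v \<le> r u" "u \<in> V" "v \<in> V" for u v
  proof (rule ccontr)
    assume nD: "\<not> D u v"
    then have "D v u" using total that by blast
    then have "{x\<in>V. D u x} \<subset> {x\<in>V. D v x}"
      using trans nD that total [of v v] by blast
    then have "r u < r v"
      unfolding r_def using fin by (intro psubset_card_mono) auto
    with that show False by simp
  qed
  have "shifted V H r"
    unfolding shifted_def
  proof (intro ballI impI)
    fix E v u assume *: "E \<in> H" "v \<in> E" "u \<in> V - E" "r v \<le> r u"
    then have "v \<in> V" using sub by (auto simp: nsets_def)
    then have "D u v" using * rD by blast
    then show "insert u (E - {v}) \<in> H" using DD * by blast
  qed
  then show ?thesis by blast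
qed

text \<open>
  The elements of \<open>E - D\<close> and \<open>D - E\<close> are equally many and can be exchanged one pair at a time,
  in any order.
\<close>

lemma shifted_upward:
  assumes sh: "shifted V H r" and fin: "finite V" and sub: "H \<subseteq> nsets V k"
    and E: "E \<in> H" and D: "D \<in> nsets V k"
    and le: "\<And>x y. x \<in> D - E \<Longrightarrow> y \<in> E - D \<Longrightarrow> r y \<le> r x"
  shows "D \<in> H"
  using E le
proof (induction "card (E - D)" arbitrary: E)
  case 0
  have "E \<in> nsets V k" using 0 sub by blast
  then have "finite E" "card E = card D" using D by (auto simp: nsets_def)
  then have "E = D"
    using 0 D by (intro card_subset_eq) (auto simp: nsets_def)
  with 0 show ?case by simp
next
  case (Suc n)
  have En: "E \<in> nsets V k" using Suc sub by blast
  then have fc: "finite E" "card E = card D" "finite D" using D by (auto simp: nsets_def)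
  obtain y where y: "y \<in> E - D" using Suc.hyps(2) by (metis card.empty ex_in_conv nat.distinct(1))
  have "card (D - E) = card (E - D)"
    using fc by (metis card_le_sym_Diff le_antisym order_refl)
  then obtain x where x: "x \<in> D - E"
    using Suc.hyps(2) by (metis card.empty ex_in_conv nat.distinct(1))
  let ?E = "insert x (E - {y})"
  have "?E \<in> H"
    using sh Suc.prems(1) x y D Suc.prems(2) by (intro shiftedD) (auto simp: nsets_def)
  moreover have "?E - D = (E - D) - {y}" "D - ?E = (D - E) - {x}"
    using x y by auto
  moreover have "n = card (?E - D)"
    using calculation Suc.hyps(2) y fc by simp
  ultimately show ?case
    using Suc.hyps(1) [of ?E] Suc.prems(2) by auto
qed

lemma ex_maximizer:
  fixes r :: "'a \<Rightarrow> nat"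
  assumes "finite S" "S \<noteq> {}"
  shows "\<exists>x\<in>S. \<forall>y\<in>S. r y \<le> r x"
proof -
  have "Max (r ` S) \<in> r ` S" using assms by simp
  then obtain x where "x \<in> S" "r x = Max (r ` S)" by auto
  then show ?thesis using assms by (intro bexI [of _ x]) auto
qed

lemma ex_top_subset:
  fixes r :: "'a \<Rightarrow> nat"
  assumes fin: "finite V" and m: "m \<le> card V"
  shows "\<exists>T \<in> nsets V m. \<forall>x\<in>T. \<forall>y\<in>V - T. r y \<le> r x"
  using m
proof (induction m)
  case 0
  then show ?case by (auto simp: nsets_def)
next
  case (Suc m)
  then obtain T where T: "T \<in> nsets V m" "\<And>x y. x \<in> T \<Longrightarrow> y \<in> V - T \<Longrightarrow> r y \<le> r x"
    by auto
  have "V - T \<noteq> {}"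
    using T Suc.prems by (auto simp: nsets_def)
  then obtain x where x: "x \<in> V - T" "\<And>y. y \<in> V - T \<Longrightarrow> r y \<le> r x"
    using ex_maximizer [of "V - T" r] fin by blast
  show ?case
  proof (intro bexI [of _ "insert x T"] ballI)
    show "insert x T \<in> nsets V (Suc m)" using T x by (auto simp: nsets_def)
    fix a b assume "a \<in> insert x T" "b \<in> V - insert x T"
    then show "r b \<le> r a" using T x by auto
  qed
qed

section \<open>Edges with one or two vertices\<close>

lemma one_hypergraph_separable:
  assumes "hypergraph 1 V H"
  shows "separable 1 V H"
  unfolding separable_def
proof (intro exI conjI ballI)
  let ?w = "\<lambda>v. of_bool ({v} \<in> H) :: real"
  show "1/2 < sum ?w E" if "E \<in> H" for E
    using that assms by (force simp: hypergraph_def nsets_def card_1_singleton_iff)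
  show "sum ?w F < 1/2" if "F \<in> hyper_compl 1 V H" for F
    using that by (auto simp: hyper_compl_def nsets_def card_1_singleton_iff)
qed

text \<open>
  Every vertex covered by the support of a balanced labeling has a positive label on an edge and
  on a non-edge, with both other endpoints covered as well. Let \<open>a\<close> be a best and \<open>b\<close> a worst
  covered vertex. Some covered neighbour of \<open>b\<close> exists, so the shifting property makes \<open>a\<close>
  adjacent to \<open>b\<close>, and then to all covered vertices, contradicting the non-edge at \<open>a\<close>.
\<close>

lemma shifted_graph_not_equatable:
  assumes hyp: "hypergraph 2 V H" and sh: "shifted V H r"
  shows "\<not> equatable 2 V H"
proof
  assume "equatable 2 V H"
  then obtain y :: "'a set \<Rightarrow> real" where y0: "\<And>E. E \<in> nsets V 2 \<Longrightarrow> y E \<ge> 0"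
    and yne: "\<exists>E \<in> nsets V 2. y E \<noteq> 0"
    and bal: "\<And>v. v \<in> V \<Longrightarrow> (\<Sum>E | E \<in> H \<and> v \<in> E. y E) = (\<Sum>F | F \<in> hyper_compl 2 V H \<and> v \<in> F. y F)"
    unfolding equatable_def by blast
  have fin: "finite V" "finite H" "finite (hyper_compl 2 V H)" and sub: "H \<subseteq> nsets V 2"
    using hyp by (auto simp: hypergraph_def hyper_compl_def intro: finite_imp_finite_nsets finite_subset)
  \<comment> \<open>The vertices covered by the support.\<close>
  define U where "U = \<Union>{E \<in> nsets V 2. y E \<noteq> 0}"
  have U: "finite U" "U \<subseteq> V" "U \<noteq> {}"
    using fin yne by (auto simp: U_def nsets_def intro: finite_subset)
  have pair: "\<exists>w\<in>U. w \<noteq> u \<and> E = {u, w}" if E: "E \<in> nsets V 2" "y E \<noteq> 0" "u \<in> E" for E u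
  proof -
    have "E \<subseteq> U" using E by (auto simp: U_def)
    moreover obtain a b where "E = {a, b}" "a \<noteq> b"
      using E(1) card_2_iff [of E] unfolding nsets_def by blast
    ultimately show ?thesis using E(3) by (metis doubleton_eq_iff insert_iff insert_subset singletonD)
  qed
  have mixed: "\<exists>w w'. w \<in> U \<and> w \<noteq> u \<and> {u, w} \<in> H \<and> w' \<in> U \<and> w' \<noteq> u \<and> {u, w'} \<notin> H" if u: "u \<in> U" for u
  proof -
    obtain E where E: "E \<in> nsets V 2" "y E \<noteq> 0" "u \<in> E" using u by (auto simp: U_def)
    have fins: "finite {E. E \<in> H \<and> u \<in> E}" "finite {E. E \<in> hyper_compl 2 V H \<and> u \<in> E}"
      using fin by auto
    have y0': "\<forall>E\<in>{E. E \<in> H \<and> u \<in> E}. 0 \<le> y E" "\<forall>E\<in>{E. E \<in> hyper_compl 2 V H \<and> u \<in> E}. 0 \<le> y E"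
      using y0 sub by (auto simp: hyper_compl_def)
    have "(\<exists>E\<in>H. u \<in> E \<and> y E \<noteq> 0) \<longleftrightarrow> (\<exists>E\<in>hyper_compl 2 V H. u \<in> E \<and> y E \<noteq> 0)"
      using bal [of u] u U sum_nonneg_eq_0_iff [OF fins(1), of y] sum_nonneg_eq_0_iff [OF fins(2), of y] y0'
      by auto
    then obtain E1 E2 where "E1 \<in> H" "u \<in> E1" "y E1 \<noteq> 0" "E2 \<in> hyper_compl 2 V H" "u \<in> E2" "y E2 \<noteq> 0"
      using E by (auto simp: hyper_compl_def)
    then show ?thesis
      using pair [of E1 u] pair [of E2 u] sub by (auto simp: hyper_compl_def)
  qed
  obtain a where aU: "a \<in> U" and amax: "\<And>x. x \<in> U \<Longrightarrow> r x \<le> r a"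
    using ex_maximizer [OF U(1,3), of r] by blast
  obtain b where b: "is_arg_min r (\<lambda>x. x \<in> U) b"
    using ex_is_arg_min_if_finite [OF U(1,3), of r] by auto
  then have bU: "b \<in> U" and bmin: "\<And>x. x \<in> U \<Longrightarrow> r b \<le> r x"
    by (auto simp: is_arg_min_def not_less)
  obtain w where w: "w \<in> U" "w \<noteq> a" "{a, w} \<notin> H" using mixed [OF aU] by blast
  obtain z where z: "z \<in> U" "z \<noteq> b" "{b, z} \<in> H" using mixed [OF bU] by blast
  \<comment> \<open>The two extreme vertices coincide only if all covered vertices have the same rank.\<close>
  have "{a, w} \<in> H"
  proof (cases "a = b")
    case True
    then have "insert w ({a, z} - {z}) \<in> H" if "w \<noteq> z"
      using that w z U amax bmin [of w] by (intro shiftedD [OF sh]) (auto intro: order_trans)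
    moreover have "insert w ({a, z} - {z}) = {a, w}" "{b, z} = {a, z}" using True z by blast+
    ultimately show ?thesis using z(3) by (cases "w = z") auto
  next
    case False
    have "insert a ({b, z} - {z}) \<in> H" if "a \<noteq> z"
      using that False z aU U amax by (intro shiftedD [OF sh]) auto
    then have ab: "{a, b} \<in> H"
      using z by (cases "a = z") (auto simp: insert_Diff_if insert_commute)
    have "insert w ({a, b} - {b}) \<in> H" if "w \<noteq> b"
      using that ab w U bmin by (intro shiftedD [OF sh]) auto
    moreover have "insert w ({a, b} - {b}) = {a, w}" using False by blast
    ultimately show ?thesis using ab by (cases "w = b") auto
  qed
  with w show False by simp
qed

section \<open>Hypergraphs around a single edge\<close>

lemma nsets_near_edge:
  assumes "E \<in> nsets V k" "B \<in> nsets V k" "p \<in> E" "p \<notin> B" "E \<subseteq> insert p B"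
  shows "\<exists>x\<in>B. E = insert p (B - {x})"
proof -
  have fc: "finite E" "finite B" "card E = k" "card B = k" using assms by (auto simp: nsets_def)
  have "\<not> B \<subseteq> E" using fc assms(3,4) card_subset_eq [of E B] by auto
  then obtain x where x: "x \<in> B" "x \<notin> E" by blast
  have "card (insert p (B - {x})) = card E"
    using fc x assms(4) card_Suc_Diff1 [of B x] by simp
  then have "E = insert p (B - {x})"
    using assms x fc by (intro card_subset_eq) auto
  with x show ?thesis by blast
qed

text \<open>
  Passing from \<open>B\<close> to another \<open>k\<close>-set exchanges \<open>m\<close> elements of weight at least 2 for \<open>m\<close> elements
  of weight at most 1 and so loses at least \<open>m\<close>. A loss of at most 1 therefore means \<open>m = 0\<close>, or
  \<open>m = 1\<close> with an element of weight 2 leaving and one of weight 1 entering, which are precisely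
  the edges.
\<close>

lemma star_separable:
  assumes sub: "H \<subseteq> nsets V k" and B: "B \<in> nsets V k" and PB: "P \<inter> B = {}" and QB: "Q \<subseteq> B"
    and H: "H = insert B {insert p (B - {x}) | p x. p \<in> P \<and> x \<in> Q}"
  shows "separable k V H"
proof -
  define w :: "'a \<Rightarrow> real" where
    "w v = (if v \<in> B then (if v \<in> Q then 2 else 3) else (if v \<in> P then 1 else 0))" for v
  define t where "t = sum w B - 3/2"
  have main: "(if F \<in> H then t < sum w F else sum w F < t)" if F: "F \<in> nsets V k" for F
  proof -
    have fc: "finite F" "finite B" "card F = card B" using F B by (auto simp: nsets_def)
    define m where "m = card (B - F)"
    have m': "card (F - B) = m"
      using fc unfolding m_def by (metis card_le_sym_Diff le_antisym order_refl)
    have wF: "sum w F = sum w B - sum w (B - F) + sum w (F - B)"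
    proof -
      have "sum w F = sum w (F \<inter> B) + sum w (F - B)" using fc by (simp add: sum.Int_Diff)
      moreover have "sum w B = sum w (F \<inter> B) + sum w (B - F)"
        using fc by (metis Int_commute sum.Int_Diff)
      ultimately show ?thesis by simp
    qed
    consider "m = 0" | "m = 1" | "2 \<le> m" by linarith
    then show ?thesis
    proof cases
      case 1
      then have "F - B = {}" using m' fc by simp
      then have "F = B" using fc by (intro card_subset_eq) auto
      then show ?thesis by (simp add: t_def H)
    next
      case 2
      then obtain x y where x: "B - F = {x}" and y: "F - B = {y}"
        using m' unfolding m_def by (metis card_1_singletonE)
      then have Feq: "F = insert y (B - {x})" by auto
      have "F \<in> H \<longleftrightarrow> x \<in> Q \<and> y \<in> P"
      proof
        assume "F \<in> H"
        moreover have "F \<noteq> B" using x by auto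
        ultimately obtain p z where pz: "p \<in> P" "z \<in> Q" "F = insert p (B - {z})"
          unfolding H by blast
        then have "F - B = {p}" "B - F = {z}" using PB QB by blast+
        with x y pz show "x \<in> Q \<and> y \<in> P" by simp
      next
        assume "x \<in> Q \<and> y \<in> P"
        then show "F \<in> H" unfolding H Feq by blast
      qed
      moreover have "x \<in> B" "y \<notin> B" using x y by auto
      ultimately show ?thesis
        unfolding wF x y t_def using QB by (auto simp: w_def)
    next
      case 3
      have "2 \<le> w v" if "v \<in> B - F" for v using that by (simp add: w_def)
      then have "2 * real m \<le> sum w (B - F)"
        using sum_bounded_below [of "B - F" 2 w] by (simp add: m_def mult.commute)
      moreover have "w v \<le> 1" if "v \<in> F - B" for v using that by (simp add: w_def)
      then have "sum w (F - B) \<le> real m"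
        using sum_bounded_above [of "F - B" w 1] m' by simp
      moreover have "F \<notin> H"
      proof
        assume "F \<in> H"
        then obtain z where "B - F \<subseteq> {z}" unfolding H by blast
        then have "m \<le> card {z}" unfolding m_def by (intro card_mono) auto
        with 3 show False by simp
      qed
      ultimately show ?thesis using 3 by (simp add: wF t_def)
    qed
  qed
  show ?thesis
    unfolding separable_def
  proof (intro exI conjI ballI)
    fix E assume E: "E \<in> H"
    show "t < sum w E" using main [of E] E sub by auto
  next
    fix F assume "F \<in> hyper_compl k V H"
    then show "sum w F < t" using main [of F] by (auto simp: hyper_compl_def)
  qed
qed

text \<open>
  Let \<open>u\<close> and \<open>v\<close> lie in different parts with \<open>u\<close> at least as good as \<open>v\<close>. An edge containing \<open>v\<close>
  but not \<open>u\<close> would, after replacing \<open>v\<close> by \<open>u\<close>, meet the part of \<open>u\<close> twice. So every edge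
  containing \<open>v\<close> contains \<open>u\<close>. This rigidity allows at most one part to have two vertices that lie
  in edges; all edges agree outside this part, and if there are edges, the hypergraph is a star
  around any of them in which \<open>Q\<close> is a single vertex.
\<close>

lemma shifted_partite_separable:
  assumes k: "1 \<le> k" and part: "partite_hypergraph k V H P" and sh: "shifted V H r"
  shows "separable k V H"
proof (cases "H = {}")
  case True
  then show ?thesis
    unfolding separable_def by (intro exI [of _ "\<lambda>_. 0"] exI [of _ 1]) auto
next
  case False
  then obtain B where B: "B \<in> H" by blast
  have sub: "H \<subseteq> nsets V k" and V: "V = (\<Union>i\<in>{1..k}. P i)" and disj: "disjoint_family_on P {1..k}"
    and one: "\<And>E i. E \<in> H \<Longrightarrow> i \<in> {1..k} \<Longrightarrow> card (E \<inter> P i) = 1"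
    using part by (auto simp: partite_hypergraph_def hypergraph_def)
  have EV: "E \<subseteq> V" if "E \<in> H" for E using that sub by (auto simp: nsets_def)
  have unique: "u = u'" if u: "E \<in> H" "i \<in> {1..k}" "u \<in> E" "u \<in> P i" "u' \<in> E" "u' \<in> P i" for E i u u'
  proof -
    obtain z where "E \<inter> P i = {z}" using one u(1,2) by (metis card_1_singletonE)
    then show ?thesis using u by (metis IntI singletonD)
  qed
  have forced: "u \<in> E"
    if uv: "i \<in> {1..k}" "j \<in> {1..k}" "i \<noteq> j" "u \<in> P i" "v \<in> P j" "r v \<le> r u" "E \<in> H" "v \<in> E"
    for u v i j E
  proof (rule ccontr)
    assume u: "u \<notin> E"
    have "u \<in> V" using V uv by blast
    then have new: "insert u (E - {v}) \<in> H" using sh uv u by (intro shiftedD) auto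
    obtain z where "E \<inter> P i = {z}" using one uv(1,7) by (metis card_1_singletonE)
    then have z: "z \<in> E" "z \<in> P i" by auto
    moreover have "v \<notin> P i" using disj uv(1-3,5) unfolding disjoint_family_on_def by blast
    ultimately have "z = u"
      using unique [OF new uv(1), of z u] uv(4) by auto
    with z u show False by simp
  qed
  have narrow: "x = x' \<or> z = z'"
    if ij: "i \<in> {1..k}" "j \<in> {1..k}" "i \<noteq> j"
      and xz: "x \<in> P i \<inter> \<Union>H" "x' \<in> P i \<inter> \<Union>H" "z \<in> P j \<inter> \<Union>H" "z' \<in> P j \<inter> \<Union>H"
    for i j x x' z z'
  proof (rule ccontr)
    assume ne: "\<not> (x = x' \<or> z = z')"
    \<comment> \<open>\<open>f u v\<close> means that \<open>u\<close> forces \<open>v\<close>. Vertices of different parts are comparable for this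
      preorder, but used vertices of one part are not. A used vertex cannot force two vertices of
      one part, and no such preorder exists on \<open>x\<close>, \<open>x'\<close>, \<open>z\<close>, \<open>z'\<close>.\<close>
    define f where "f u v \<longleftrightarrow> (\<forall>E\<in>H. u \<in> E \<longrightarrow> v \<in> E)" for u v
    have comp: "f u v \<or> f v u" if "u \<in> P i" "v \<in> P j" for u v
    proof (cases "r v \<le> r u")
      case True
      then show ?thesis using forced [OF ij that] by (auto simp: f_def)
    next
      case False
      then show ?thesis using forced [OF ij(2,1) ij(3)[symmetric] that(2,1)] by (auto simp: f_def)
    qed
    have ftrans: "f u w" if "f u v" "f v w" for u v w using that by (auto simp: f_def)
    have noti: "\<not> f u u'" if "u \<in> P i \<inter> \<Union>H" "u' \<in> P i" "u \<noteq> u'" for u u'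
      using that unique [OF _ ij(1)] unfolding f_def by blast
    have notj: "\<not> f u u'" if "u \<in> P j \<inter> \<Union>H" "u' \<in> P j" "u \<noteq> u'" for u u'
      using that unique [OF _ ij(2)] unfolding f_def by blast
    have "\<not> f x x'" "\<not> f x' x" "\<not> f z z'" "\<not> f z' z"
      using noti [of x x'] noti [of x' x] notj [of z z'] notj [of z' z] ne xz by blast+
    moreover have "f x z \<or> f z x" "f x z' \<or> f z' x" "f x' z \<or> f z x'" "f x' z' \<or> f z' x'"
      using comp xz by blast+
    moreover have "\<not> (f x z \<and> f x z')"
    proof
      assume "f x z \<and> f x z'"
      moreover obtain E where "E \<in> H" "x \<in> E" using xz by blast
      ultimately have "z \<in> E" "z' \<in> E" by (auto simp: f_def)
      then show False using unique [OF \<open>E \<in> H\<close> ij(2)] xz ne by blast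
    qed
    moreover have "\<not> (f z x \<and> f z x')"
    proof
      assume "f z x \<and> f z x'"
      moreover obtain E where "E \<in> H" "z \<in> E" using xz by blast
      ultimately have "x \<in> E" "x' \<in> E" by (auto simp: f_def)
      then show False using unique [OF \<open>E \<in> H\<close> ij(1)] xz ne by blast
    qed
    ultimately show False using ftrans by blast
  qed
  obtain i where i: "i \<in> {1..k}"
    and rest: "\<And>j z z'. j \<in> {1..k} \<Longrightarrow> j \<noteq> i \<Longrightarrow> z \<in> P j \<inter> \<Union>H \<Longrightarrow> z' \<in> P j \<inter> \<Union>H \<Longrightarrow> z = z'"
  proof (cases "\<exists>i\<in>{1..k}. \<exists>x x'. x \<in> P i \<inter> \<Union>H \<and> x' \<in> P i \<inter> \<Union>H \<and> x \<noteq> x'")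
    case True
    then obtain i x x' where "i \<in> {1..k}" "x \<in> P i \<inter> \<Union>H" "x' \<in> P i \<inter> \<Union>H" "x \<noteq> x'" by blast
    then show thesis using narrow that [of i] by metis
  next
    case False
    then show thesis using k that [of 1] by (metis atLeastAtMost_iff order_refl)
  qed
  obtain x where x: "B \<inter> P i = {x}" using one [OF B i] by (metis card_1_singletonE)
  define N where "N = {p \<in> V - B. insert p (B - {x}) \<in> H}"
  have "H = insert B {insert p (B - {q}) | p q. p \<in> N \<and> q \<in> {x}}"
  proof (rule set_eqI, rule iffI)
    fix E assume E: "E \<in> H"
    have incl: "E1 - P i \<subseteq> E2" if E12: "E1 \<in> H" "E2 \<in> H" for E1 E2
    proof
      fix z assume z: "z \<in> E1 - P i"
      then obtain j where j: "j \<in> {1..k}" "z \<in> P j" using EV [OF E12(1)] V by blast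
      obtain z' where "E2 \<inter> P j = {z'}" using one [OF E12(2) j(1)] by (metis card_1_singletonE)
      then show "z \<in> E2" using rest [of j z z'] j z E12 by blast
    qed
    obtain p where p: "E \<inter> P i = {p}" using one [OF E i] by (metis card_1_singletonE)
    have Eeq: "E = insert p (B - {x})"
      using incl [OF E B] incl [OF B E] p x by blast
    show "E \<in> insert B {insert p (B - {q}) | p q. p \<in> N \<and> q \<in> {x}}"
    proof (cases "p \<in> B")
      case True
      then have "p = x" using p x by blast
      then show ?thesis using Eeq x by blast
    next
      case False
      moreover have "p \<in> V" using p EV [OF E] by blast
      ultimately show ?thesis using E Eeq unfolding N_def by blast
    qed
  next
    fix E assume "E \<in> insert B {insert p (B - {q}) | p q. p \<in> N \<and> q \<in> {x}}"
    then show "E \<in> H" using B unfolding N_def by blast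
  qed
  then show ?thesis
    using sub B x by (intro star_separable [of H V k B N "{x}"]) (auto simp: N_def)
qed

section \<open>Exchange in matroids, and paving matroids\<close>

text \<open>
  An element of \<open>E\<close> outside \<open>I\<close> and \<open>B\<close> can be exchanged for an element of \<open>B\<close>, which brings \<open>E\<close>
  closer to \<open>I \<union> B\<close>.
\<close>

lemma matroid_augment:
  assumes M: "matroid k V H" and E: "E \<in> H" and B: "B \<in> H" and I: "I \<subseteq> E"
  shows "\<exists>E'\<in>H. I \<subseteq> E' \<and> E' \<subseteq> I \<union> B"
  using E I
proof (induction "card (E - (I \<union> B))" arbitrary: E rule: less_induct)
  case less
  show ?case
  proof (cases "E \<subseteq> I \<union> B")
    case True
    then show ?thesis using less.prems by blast
  next
    case False
    then obtain v where v: "v \<in> E" "v \<notin> I" "v \<notin> B" by blast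
    then obtain b where b: "b \<in> B - E" "insert b (E - {v}) \<in> H"
      using M less.prems(1) B unfolding matroid_def by (metis DiffI Un_insert_right sup_bot_right)
    have "finite E"
      using M less.prems(1) unfolding matroid_def hypergraph_def nsets_def by blast
    then have "card (insert b (E - {v}) - (I \<union> B)) < card (E - (I \<union> B))"
      using v b by (intro psubset_card_mono) auto
    then show ?thesis
      using less.hyps [OF _ b(2)] less.prems(2) v by blast
  qed
qed

text \<open>
  An independent set \<open>L\<close> of size \<open>k - 1\<close> spans a hyperplane, consisting of the \<open>x\<close> for which
  \<open>insert x L\<close> is not a basis, and no basis is contained in a hyperplane. Elements of \<open>L\<close> are
  included in this description, since \<open>insert x L\<close> is then too small.
\<close>

lemma matroid_span:
  assumes M: "matroid k V H" and L: "L \<subseteq> E" "E \<in> H" "card L = k - 1" and k: "1 \<le> k" and D: "D \<in> H"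
  shows "\<exists>x\<in>D. insert x L \<in> H"
proof -
  obtain E' where E': "E' \<in> H" "L \<subseteq> E'" "E' \<subseteq> L \<union> D"
    using matroid_augment [OF M L(2) D L(1)] by blast
  have fin: "finite E'" "card E' = k"
    using M E' unfolding matroid_def hypergraph_def nsets_def by auto
  then have "card (E' - L) = 1"
    using E' L k by (simp add: card_Diff_subset finite_subset)
  then obtain x where "E' - L = {x}" by (metis card_1_singletonE)
  then have "x \<in> D" "insert x L = E'" using E' by blast+
  with E' show ?thesis by blast
qed

text \<open>
  Let \<open>L\<close> consist of the \<open>k - 1\<close> worst vertices; it is independent because the matroid is paving.
  If a \<open>k\<close>-set contains some \<open>d\<close> outside the hyperplane spanned by \<open>L\<close>, then it arises from the
  basis \<open>insert d L\<close> by replacing members of \<open>L\<close> by vertices that are at least as good, so it is a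
  basis. Hence the non-bases are the \<open>k\<close>-subsets of a single hyperplane.
\<close>

lemma shifted_paving_separable:
  assumes k: "1 \<le> k" "k < card V" and pav: "paving_matroid k V H" and sh: "shifted V H r"
  shows "separable k V H"
proof -
  have M: "matroid k V H" and fin: "finite V" and sub: "H \<subseteq> nsets V k"
    using pav by (auto simp: paving_matroid_def matroid_def hypergraph_def)
  obtain T where T: "T \<in> nsets V (card V - (k - 1))" and top: "\<And>x y. x \<in> T \<Longrightarrow> y \<in> V - T \<Longrightarrow> r y \<le> r x"
    using ex_top_subset [OF fin, of "card V - (k - 1)" r] by auto
  define L where "L = V - T"
  have cL: "card L = k - 1" and LV: "L \<subseteq> V" "finite L"
    using T k fin by (auto simp: L_def nsets_def card_Diff_subset)
  then have "L \<in> nsets V (k - 1)" by (simp add: nsets_def)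
  then obtain E0 where E0: "E0 \<in> H" "L \<subseteq> E0"
    using pav unfolding paving_matroid_def independent_set_def by blast
  have iff: "D \<in> H \<longleftrightarrow> (\<exists>d\<in>D. insert d L \<in> H)" if D: "D \<in> nsets V k" for D
  proof
    assume "D \<in> H"
    then show "\<exists>d\<in>D. insert d L \<in> H" using matroid_span [OF M E0(2,1) cL k(1)] by blast
  next
    assume "\<exists>d\<in>D. insert d L \<in> H"
    then obtain d where d: "d \<in> D" "insert d L \<in> H" by blast
    show "D \<in> H"
    proof (rule shifted_upward [OF sh fin sub d(2) D])
      fix x y assume "x \<in> D - insert d L" "y \<in> insert d L - D"
      then have "x \<in> T" "y \<in> V - T" using d D unfolding L_def nsets_def by auto
      then show "r y \<le> r x" by (rule top)
    qed
  qed
  \<comment> \<open>Weight 1 outside the hyperplane and 0 inside.\<close>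
  define w :: "'a \<Rightarrow> real" where "w v = of_bool (insert v L \<in> H)" for v
  have pos: "1/2 < sum w D \<longleftrightarrow> D \<in> H" and ne: "sum w D \<noteq> 1/2" if D: "D \<in> nsets V k" for D
  proof -
    have "finite D" using D by (simp add: nsets_def)
    then have "sum w D = real (card {d \<in> D. insert d L \<in> H})"
      by (simp add: w_def sum.If_cases of_bool_def Collect_conj_eq)
    moreover have "card {d \<in> D. insert d L \<in> H} = 0 \<longleftrightarrow> D \<notin> H"
      using \<open>finite D\<close> iff [OF D] by auto
    ultimately show "1/2 < sum w D \<longleftrightarrow> D \<in> H" "sum w D \<noteq> 1/2"
      by (cases "card {d \<in> D. insert d L \<in> H}"; simp)+
  qed
  show ?thesis
    unfolding separable_def
  proof (intro exI conjI ballI)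
    show "1/2 < sum w E" if "E \<in> H" for E using that pos sub by blast
    show "sum w F < 1/2" if "F \<in> hyper_compl k V H" for F
      using that pos [of F] ne [of F] by (auto simp: hyper_compl_def)
  qed
qed

section \<open>Binary matroids\<close>

definition fundamental_circuit :: "'a set set \<Rightarrow> 'a set \<Rightarrow> 'a \<Rightarrow> 'a set" where
  "fundamental_circuit H B p = insert p {x \<in> B. insert p (B - {x}) \<in> H}"

text \<open>
  If the set were independent, it would extend to a basis inside \<open>insert p B\<close>. Such a basis omits
  exactly one \<open>x\<close> in \<open>B\<close>, but every such \<open>x\<close> belongs to the set by construction.
\<close>

lemma circuit_fundamental:
  assumes M: "matroid k V H" and B: "B \<in> H" and p: "p \<in> V - B"
  shows "circuit V H (fundamental_circuit H B p)" (is "circuit V H ?C")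
proof -
  have sub: "H \<subseteq> nsets V k" using M by (simp add: matroid_def hypergraph_def)
  then have BV: "B \<subseteq> V" using B by (auto simp: nsets_def)
  have CV: "?C \<subseteq> V" using BV p by (auto simp: fundamental_circuit_def)
  have "\<not> independent_set V H ?C"
  proof
    assume "independent_set V H ?C"
    then obtain E where "E \<in> H" "?C \<subseteq> E" unfolding independent_set_def by blast
    then obtain E' where E': "E' \<in> H" "?C \<subseteq> E'" "E' \<subseteq> ?C \<union> B"
      using matroid_augment [OF M _ B] by blast
    then have "E' \<subseteq> insert p B" "p \<in> E'" by (auto simp: fundamental_circuit_def)
    then obtain x where x: "x \<in> B" "E' = insert p (B - {x})"
      using nsets_near_edge [of E' V k B p] E' sub B p by blast
    then have "x \<in> ?C" using E' by (simp add: fundamental_circuit_def)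
    then have "x \<in> E'" using E' by blast
    then show False using x p by auto
  qed
  moreover have "independent_set V H I" if I: "I \<subset> ?C" for I
  proof -
    obtain x where x: "x \<in> ?C" "x \<notin> I" using I by blast
    show ?thesis
    proof (cases "x = p")
      case True
      then have "I \<subseteq> B" using I x by (auto simp: fundamental_circuit_def)
      then show ?thesis using B BV unfolding independent_set_def by blast
    next
      case False
      then have "insert p (B - {x}) \<in> H" using x by (simp add: fundamental_circuit_def)
      moreover have "I \<subseteq> insert p (B - {x})" using I x by (auto simp: fundamental_circuit_def)
      moreover have "I \<subseteq> V" using I CV by blast
      ultimately show ?thesis unfolding independent_set_def by blast
    qed
  qed
  ultimately show ?thesis using CV unfolding circuit_def by blast
qed

text \<open>
  The independent set \<open>C - {x}\<close> extends to a basis inside \<open>insert p B\<close>. This basis cannot contain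
  \<open>x\<close>, because it would contain the circuit \<open>C\<close>, so it is all of \<open>insert p B\<close> except \<open>x\<close>.
\<close>

lemma circuit_exchange:
  assumes M: "matroid k V H" and B: "B \<in> H" and p: "p \<in> V - B"
    and C: "circuit V H C" "C \<subseteq> insert p B" and x: "x \<in> C" "x \<in> B"
  shows "insert p (B - {x}) \<in> H"
proof -
  have sub: "H \<subseteq> nsets V k" using M by (simp add: matroid_def hypergraph_def)
  have "C - {x} \<subset> C" using x by blast
  then have "independent_set V H (C - {x})"
    using C(1) by (simp add: circuit_def)
  then obtain E where "E \<in> H" "C - {x} \<subseteq> E"
    unfolding independent_set_def by blast
  then obtain E' where E': "E' \<in> H" "C - {x} \<subseteq> E'" "E' \<subseteq> (C - {x}) \<union> B"
    using matroid_augment [OF M _ B] by blast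
  have "x \<notin> E'"
  proof
    assume "x \<in> E'"
    then have "C \<subseteq> E'" using E' by blast
    then show False using C E' unfolding circuit_def independent_set_def by blast
  qed
  moreover have "E' \<subseteq> insert p B" using E' C by blast
  moreover have "p \<in> E'"
  proof (rule ccontr)
    assume "p \<notin> E'"
    then have "E' \<subset> B" using calculation x by blast
    moreover have "finite B" "card E' = card B" using B E' sub by (auto simp: nsets_def)
    ultimately show False by (metis psubset_card_mono less_irrefl)
  qed
  ultimately obtain z where z: "z \<in> B" "E' = insert p (B - {z})"
    using nsets_near_edge [of E' V k B p] E' sub B p by blast
  then have "z = x" using \<open>x \<notin> E'\<close> x by blast
  then show ?thesis using z E' by simp
qed

lemma circuit_in_sym_diff:
  assumes "binary_matroid k V H" "circuit V H C1" "circuit V H C2" "x \<in> sym_diff C1 C2"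
  shows "\<exists>D. circuit V H D \<and> x \<in> D \<and> D \<subseteq> sym_diff C1 C2"
proof -
  have "C1 \<noteq> C2" using assms(4) by blast
  then obtain \<D> where "\<forall>D\<in>\<D>. circuit V H D" "\<Union>\<D> = sym_diff C1 C2"
    using assms unfolding binary_matroid_def by blast
  then show ?thesis using assms(4) by blast
qed

text \<open>
  The \<open>k\<close> best vertices form a basis \<open>B\<close>. For a vertex \<open>p\<close> outside \<open>B\<close> let \<open>X p\<close> be the fundamental
  circuit of \<open>p\<close> without \<open>p\<close>, so that \<open>p\<close> is a loop if and only if \<open>X p\<close> is empty. The point is that
  \<open>X p\<close> is the same for all non-loops. Let the non-loop \<open>p\<close> be at least as good as the non-loop
  \<open>p'\<close>; then \<open>X p\<close> contains \<open>X p'\<close>, by shifting. Suppose that \<open>x\<close> lies in \<open>X p\<close> but not in \<open>X p'\<close>, and let \<open>z\<close> be in \<open>X p'\<close>. As the matroid is binary,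
  the symmetric difference of the two fundamental circuits contains a circuit through \<open>x\<close>, and this
  circuit avoids \<open>z\<close>. It shows that \<open>B\<close> with \<open>x\<close>, \<open>z\<close> replaced by \<open>p\<close>, \<open>p'\<close> is a basis. Since \<open>z\<close>
  belongs to \<open>B\<close> and is therefore at least as good as \<open>p\<close>, replacing \<open>p\<close> by \<open>z\<close> gives a basis
  again, which puts \<open>x\<close> into \<open>X p'\<close>.

  Once the sets \<open>X p\<close> agree, the symmetric difference of two fundamental circuits is a pair
  \<open>{p, p'}\<close>, which is dependent. So a basis contains at most one vertex outside \<open>B\<close>, and the
  bases form a star.
\<close>

lemma shifted_binary_separable:
  assumes k: "k < card V" and bin: "binary_matroid k V H" and sh: "shifted V H r"
  shows "separable k V H"
proof -
  have M: "matroid k V H" and fin: "finite V" and sub: "H \<subseteq> nsets V k" and "H \<noteq> {}"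
    using bin by (auto simp: binary_matroid_def matroid_def hypergraph_def)
  then obtain E0 where E0: "E0 \<in> H" by blast
  obtain B where Bn: "B \<in> nsets V k" and top: "\<And>x y. x \<in> B \<Longrightarrow> y \<in> V - B \<Longrightarrow> r y \<le> r x"
    using ex_top_subset [OF fin, of k r] k by auto
  have EV: "E \<subseteq> V" if "E \<in> H" for E using that sub by (auto simp: nsets_def)
  have B: "B \<in> H"
    by (rule shifted_upward [OF sh fin sub E0 Bn]) (use top EV [OF E0] in blast)
  define X where "X p = {x \<in> B. insert p (B - {x}) \<in> H}" for p
  define P where "P = {p \<in> V - B. X p \<noteq> {}}"
  have circ: "circuit V H (insert p (X p))" if "p \<in> V - B" for p
    using circuit_fundamental [OF M B that] by (simp add: fundamental_circuit_def X_def)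
  have BV: "B \<subseteq> V" by (rule EV [OF B])
  have XB: "X p \<subseteq> B" for p by (auto simp: X_def)
  have Xmono: "X p' \<subseteq> X p" if p: "p \<in> P" "p' \<in> P" "r p' \<le> r p" for p p'
  proof
    fix x assume x: "x \<in> X p'"
    show "x \<in> X p"
    proof (cases "p = p'")
      case False
      have "insert p (insert p' (B - {x}) - {p'}) \<in> H"
        by (rule shiftedD [OF sh]) (use x p False in \<open>auto simp: X_def P_def\<close>)
      moreover have "insert p' (B - {x}) - {p'} = B - {x}" using p by (auto simp: P_def)
      ultimately show ?thesis using x by (simp add: X_def)
    qed (use x in simp)
  qed
  have Xle: "X p \<subseteq> X p'" if p: "p \<in> P" "p' \<in> P" "r p' \<le> r p" for p p'
  proof
    fix x assume x: "x \<in> X p"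
    show "x \<in> X p'"
    proof (rule ccontr)
      assume x': "x \<notin> X p'"
      obtain z where z: "z \<in> X p'" using p by (auto simp: P_def)
      then have zp: "z \<in> X p" using Xmono [OF p] by blast
      have pne: "p \<noteq> p'" using x x' by blast
      have pB: "p \<notin> B" "p' \<notin> B" "p \<in> V" "p' \<in> V" using p by (auto simp: P_def)
      have xz: "x \<in> B" "z \<in> B" "x \<noteq> z" using x z x' by (auto simp: X_def)
      have E1: "insert p' (B - {z}) \<in> H" using z by (simp add: X_def)
      have "x \<in> sym_diff (insert p (X p)) (insert p' (X p'))"
        using x x' xz pB by blast
      then obtain D where D: "circuit V H D" "x \<in> D" "D \<subseteq> sym_diff (insert p (X p)) (insert p' (X p'))"
        using circuit_in_sym_diff [OF bin circ circ] pB by blast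
      have "D \<subseteq> insert p (insert p' (B - {z}))"
        using D(3) z zp XB by blast
      then have "insert p (insert p' (B - {z}) - {x}) \<in> H"
        using pB pne xz D by (intro circuit_exchange [OF M E1 _ D(1)]) auto
      then have "insert z (insert p (insert p' (B - {z}) - {x}) - {p}) \<in> H"
        by (rule shiftedD [OF sh]) (use pB pne xz BV top in auto)
      moreover have "insert z (insert p (insert p' (B - {z}) - {x}) - {p}) = insert p' (B - {x})"
        using pB pne xz by blast
      ultimately show False using x' xz by (simp add: X_def)
    qed
  qed
  have Xeq: "X p = X p'" if "p \<in> P" "p' \<in> P" for p p'
    using that Xmono Xle by (meson nat_le_linear subset_antisym)
  define Q where "Q = (\<Union>p\<in>P. X p)"
  have "H = insert B {insert p (B - {x}) | p x. p \<in> P \<and> x \<in> Q}"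
  proof (rule set_eqI, rule iffI)
    fix E assume E: "E \<in> H"
    have new: "p \<in> P" if p: "p \<in> E - B" for p
    proof -
      obtain E' where E': "E' \<in> H" "{p} \<subseteq> E'" "E' \<subseteq> {p} \<union> B"
        using matroid_augment [OF M E B, of "{p}"] p by blast
      then obtain x where "x \<in> B" "E' = insert p (B - {x})"
        using nsets_near_edge [of E' V k B p] sub Bn p by blast
      then show ?thesis using E' p EV [OF E] by (auto simp: P_def X_def)
    qed
    have single: "p = p'" if p: "p \<in> E - B" "p' \<in> E - B" for p p'
    proof (rule ccontr)
      assume pne: "p \<noteq> p'"
      have X: "X p = X p'" using Xeq new p by blast
      have pV: "p \<in> V - B" "p' \<in> V - B" using p EV [OF E] by blast+
      have "p \<in> sym_diff (insert p (X p)) (insert p' (X p'))"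
        using pne pV XB by blast
      then obtain D where D: "circuit V H D" "D \<subseteq> sym_diff (insert p (X p)) (insert p' (X p'))"
        using circuit_in_sym_diff [OF bin circ circ] pV by blast
      then have "D \<subseteq> E" using X p by blast
      then show False using D(1) E unfolding circuit_def independent_set_def by blast
    qed
    show "E \<in> insert B {insert p (B - {x}) | p x. p \<in> P \<and> x \<in> Q}"
    proof (cases "E \<subseteq> B")
      case True
      have "finite B" "card E = card B" using Bn E sub by (auto simp: nsets_def)
      then have "E = B" using True by (intro card_subset_eq)
      then show ?thesis by simp
    next
      case False
      then obtain p where p: "p \<in> E" "p \<notin> B" by blast
      then have "E \<subseteq> insert p B" using single by blast
      then obtain x where x: "x \<in> B" "E = insert p (B - {x})"
        using nsets_near_edge [of E V k B p] E sub Bn p by blast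
      moreover have "p \<in> P" using new p by blast
      moreover have "x \<in> Q" using x E \<open>p \<in> P\<close> by (auto simp: Q_def X_def)
      ultimately show ?thesis by blast
    qed
  next
    fix E assume "E \<in> insert B {insert p (B - {x}) | p x. p \<in> P \<and> x \<in> Q}"
    then consider "E = B" | p x p' where "E = insert p (B - {x})" "p \<in> P" "p' \<in> P" "x \<in> X p'"
      unfolding Q_def by blast
    then show "E \<in> H"
    proof cases
      case 2
      then have "x \<in> X p" using Xeq by blast
      with 2 show ?thesis by (simp add: X_def)
    qed (use B in simp)
  qed
  moreover have "P \<inter> B = {}" by (auto simp: P_def)
  moreover have "Q \<subseteq> B" using XB unfolding Q_def by blast
  ultimately show ?thesis
    using star_separable [OF sub Bn] by blast
qed

section \<open>Matroids of rank three\<close>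

text \<open>
  Let \<open>c\<close> be a worst non-loop and \<open>b\<close> a worst vertex among those that are independent of \<open>c\<close>. Besides
  the loops there are three classes: the parallel class of \<open>c\<close>, the other points of the line
  spanned by \<open>b\<close> and \<open>c\<close>, and the points \<open>X\<close> off this line. A basis has a point in \<open>X\<close> and at most one
  point parallel to \<open>c\<close>. Conversely a triple of non-loops with these properties is obtained from a
  basis \<open>{x, b, c}\<close> by replacing \<open>b\<close> and \<open>c\<close> by vertices that are at least as good. With weights 0,
  1, 3 on the classes, a basis has weight at least \<open>3 + 1 + 0\<close>, and a triple that avoids \<open>X\<close> or has
  two points parallel to \<open>c\<close> has weight at most 3. The weight -6 excludes loops, since the other two
  points contribute at most 6.
\<close>

lemma shifted_rank_three_separable:
  assumes M: "matroid 3 V H" and sh: "shifted V H r"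
  shows "separable 3 V H"
proof -
  have fin: "finite V" and sub: "H \<subseteq> nsets V 3" and "H \<noteq> {}"
    using M by (auto simp: matroid_def hypergraph_def)
  then obtain E0 where E0: "E0 \<in> H" by blast
  have EV: "E \<subseteq> V" "card E = 3" "finite E" if "E \<in> H" for E using that sub by (auto simp: nsets_def)
  have "finite (\<Union>H)"
    using EV(1) fin by (meson Union_least finite_subset)
  moreover have "\<Union>H \<noteq> {}"
    using E0 EV(2) [OF E0] by (metis Union_upper card.empty subset_empty zero_neq_numeral)
  ultimately obtain c where "is_arg_min r (\<lambda>x. x \<in> \<Union>H) c"
    using ex_is_arg_min_if_finite by metis
  then have c: "c \<in> \<Union>H" and cmin: "\<And>x. x \<in> \<Union>H \<Longrightarrow> r c \<le> r x"
    by (auto simp only: is_arg_min_def not_less)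
  \<comment> \<open>The non-loops that are not parallel to \<open>c\<close>.\<close>
  define N where "N = {x. x \<noteq> c \<and> (\<exists>E\<in>H. x \<in> E \<and> c \<in> E)}"
  have "N \<noteq> {}"
  proof -
    obtain E where E: "E \<in> H" "c \<in> E" using c by blast
    then have "E \<noteq> {c}" using EV(2) [OF E(1)] by auto
    then show ?thesis using E unfolding N_def by blast
  qed
  moreover have "finite N" using EV(1) fin by (auto simp: N_def intro: finite_subset)
  ultimately obtain b where "is_arg_min r (\<lambda>x. x \<in> N) b"
    using ex_is_arg_min_if_finite by metis
  then have b: "b \<in> N" and bmin: "\<And>x. x \<in> N \<Longrightarrow> r b \<le> r x"
    by (auto simp only: is_arg_min_def not_less)
  obtain Ebc where Ebc: "Ebc \<in> H" "b \<in> Ebc" "c \<in> Ebc" and bc: "b \<noteq> c"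
    using b unfolding N_def by blast
  define X where "X = {x. {x, b, c} \<in> H}"
  have XN: "X \<subseteq> N"
  proof
    fix x assume "x \<in> X"
    then have x: "{x, b, c} \<in> H" by (simp add: X_def)
    then have "x \<noteq> c" using EV(2) [OF x] by (auto simp: card_insert_if split: if_splits)
    then show "x \<in> N" using x by (auto simp: N_def)
  qed
  have XV: "x \<in> V \<and> x \<noteq> b \<and> x \<noteq> c" if "x \<in> X" for x
  proof -
    have x: "{x, b, c} \<in> H" using that by (simp add: X_def)
    then show ?thesis using EV(1,2) [OF x] by (auto simp: card_insert_if split: if_splits)
  qed
  have NH: "N \<subseteq> \<Union>H" by (auto simp: N_def)
  \<comment> \<open>Two points parallel to \<open>c\<close> are parallel to each other.\<close>
  have pairN: "p \<in> N \<or> q \<in> N" if E: "E \<in> H" "p \<in> E" "q \<in> E" "p \<noteq> q" for E p q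
  proof (cases "c \<in> E")
    case True
    then show ?thesis using E unfolding N_def by blast
  next
    case False
    obtain C where C: "C \<in> H" "c \<in> C" using c by blast
    then obtain E' where E': "E' \<in> H" "{c} \<subseteq> E'" "E' \<subseteq> {c} \<union> E"
      using matroid_augment [OF M C(1) E(1), of "{c}"] by blast
    then obtain x where x: "x \<in> E" "E' = insert c (E - {x})"
      using nsets_near_edge [of E' V 3 E c] sub E(1) False by blast
    then have "p \<in> E' \<or> q \<in> E'" using E by blast
    then show ?thesis using E' E False unfolding N_def by blast
  qed
  have fwd: "\<exists>x q s. E = {x, q, s} \<and> x \<noteq> q \<and> x \<noteq> s \<and> q \<noteq> s \<and> x \<in> X \<and> q \<in> N \<and> s \<in> \<Union>H"
    if E: "E \<in> H" for E
  proof -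
    have "card {b, c} = 3 - 1" using bc by simp
    then obtain x where x: "x \<in> E" "x \<in> X"
      using matroid_span [OF M _ Ebc(1) _ _ E, of "{b, c}"] Ebc unfolding X_def by auto
    have "card (E - {x}) = 2" using x EV [OF E] by simp
    then obtain p q where pq: "E - {x} = {p, q}" "p \<noteq> q" by (meson card_2_iff)
    then have pqE: "E = {x, p, q}" "E = {x, q, p}" "p \<in> E" "q \<in> E" "x \<noteq> p" "x \<noteq> q" using x by blast+
    then have "p \<in> N \<or> q \<in> N" using pairN [OF E] pq by blast
    moreover have "p \<in> \<Union>H" "q \<in> \<Union>H" using pqE E by blast+
    ultimately show ?thesis using pqE pq(2) x(2) by metis
  qed
  have bwd: "{x, q, s} \<in> H"
    if xqs: "x \<noteq> q" "x \<noteq> s" "q \<noteq> s" "x \<in> X" "q \<in> N" "s \<in> \<Union>H" for x q s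
  proof -
    have V: "q \<in> V" "s \<in> V" using xqs NH EV(1) by blast+
    have x: "{x, b, c} \<in> H" using xqs by (simp add: X_def)
    have qc: "q \<noteq> c" using xqs by (simp add: N_def)
    have xq: "{x, q, c} \<in> H"
    proof (cases "q = b")
      case False
      have "insert q ({x, b, c} - {b}) \<in> H"
        by (rule shiftedD [OF sh x]) (use False V qc xqs bmin in auto)
      moreover have "insert q ({x, b, c} - {b}) = {x, q, c}"
        using XV [OF xqs(4)] bc by blast
      ultimately show ?thesis by simp
    qed (use x in simp)
    show ?thesis
    proof (cases "s = c")
      case False
      have "insert s ({x, q, c} - {c}) \<in> H"
        by (rule shiftedD [OF sh xq]) (use False V xqs cmin in auto)
      moreover have "insert s ({x, q, c} - {c}) = {x, q, s}"
        using XV [OF xqs(4)] qc by blast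
      ultimately show ?thesis by simp
    qed (use xq in simp)
  qed
  define w :: "'a \<Rightarrow> real" where
    "w v = (if v \<notin> \<Union>H then - 6 else if v \<in> X then 3 else if v \<in> N then 1 else 0)" for v
  have wX: "w v = 3" if "v \<in> X" for v using that XN NH by (auto simp: w_def)
  have wN: "1 \<le> w v" if "v \<in> N" for v using that NH by (auto simp: w_def)
  have wH: "0 \<le> w v" if "v \<in> \<Union>H" for v using that by (auto simp: w_def)
  have sum3: "sum w {x, q, s} = w x + w q + w s" if "x \<noteq> q" "x \<noteq> s" "q \<noteq> s" for x q s
    using that by simp
  show ?thesis
    unfolding separable_def
  proof (intro exI conjI ballI)
    fix E assume "E \<in> H"
    then obtain x q s where "E = {x, q, s}" "x \<noteq> q" "x \<noteq> s" "q \<noteq> s" "x \<in> X" "q \<in> N" "s \<in> \<Union>H"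
      using fwd by blast
    then show "7/2 < sum w E" using sum3 [of x q s] wX [of x] wN [of q] wH [of s] by simp
  next
    fix F assume F: "F \<in> hyper_compl 3 V H"
    then obtain x q s where xqs: "F = {x, q, s}" "x \<noteq> q" "x \<noteq> s" "q \<noteq> s"
      unfolding hyper_compl_def nsets_def by (auto simp: card_3_iff)
    show "sum w F < 7/2"
    proof (rule ccontr)
      assume "\<not> sum w F < 7/2"
      then have big: "7/2 \<le> w x + w q + w s" using sum3 [of x q s] xqs by simp
      have w_le: "w v \<le> 3" for v by (simp add: w_def)
      have nl: "x \<in> \<Union>H" "q \<in> \<Union>H" "s \<in> \<Union>H"
        using big w_le [of x] w_le [of q] w_le [of s] unfolding w_def by (auto split: if_splits)
      have cases: "v \<in> X \<and> v \<in> N \<and> w v = 3 \<or> v \<notin> X \<and> v \<in> N \<and> w v = 1 \<or> v \<notin> X \<and> v \<notin> N \<and> w v = 0"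
        if "v \<in> \<Union>H" for v
        using that XN by (auto simp: w_def)
      have notH: "{x, q, s} \<notin> H" using F xqs by (simp add: hyper_compl_def)
      have "\<not> (u \<in> X \<and> v \<in> N)" if "{u, v, t} = {x, q, s}" "u \<noteq> v" "u \<noteq> t" "v \<noteq> t" "t \<in> \<Union>H" for u v t
        using bwd [of u v t] that notH by auto
      note no = this
      have "\<not> (x \<in> X \<and> q \<in> N)" "\<not> (x \<in> X \<and> s \<in> N)" "\<not> (q \<in> X \<and> x \<in> N)"
        "\<not> (q \<in> X \<and> s \<in> N)" "\<not> (s \<in> X \<and> x \<in> N)" "\<not> (s \<in> X \<and> q \<in> N)"
        by (rule no; use xqs nl in blast)+
      then show False
        using cases [OF nl(1)] cases [OF nl(2)] cases [OF nl(3)] big by auto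
    qed
  qed
qed

section \<open>Equatable and exchangeable hypergraphs\<close>

theorem theorem1p3:
  fixes V :: "'a set" and H :: "'a set set" and k :: nat
  assumes "1 \<le> k" and "k < card V" and "hypergraph k V H"
    and "k \<in> {1, 2}
         \<or> (\<exists>P. partite_hypergraph k V H P)
         \<or> paving_matroid k V H
         \<or> binary_matroid k V H
         \<or> (k = 3 \<and> matroid 3 V H)"
  shows "equatable k V H \<longleftrightarrow> exchangeable k V H"
proof
  assume eq: "equatable k V H"
  show "exchangeable k V H"
  proof (rule ccontr)
    assume "\<not> exchangeable k V H"
    then obtain r where sh: "shifted V H r"
      using not_exchangeable_imp_shifted assms(3) by blast
    have "k \<noteq> 2"
      using shifted_graph_not_equatable [OF _ sh] assms(3) eq by blast
    then have "separable k V H"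
      using assms(4) one_hypergraph_separable [of V H] assms(3)
        shifted_partite_separable [OF assms(1) _ sh] shifted_paving_separable [OF assms(1,2) _ sh]
        shifted_binary_separable [OF assms(2) _ sh] shifted_rank_three_separable [OF _ sh]
      by blast
    then show False
      using separable_imp_not_equatable [OF assms(1,3)] eq by blast
  qed
next
  assume "exchangeable k V H"
  then show "equatable k V H"
    using exchangeable_imp_equatable assms(3) by blast
qed

end
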